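(* Let $n\ge1$ and let $H_n$ be the pyrene system with $n$ pyrene fragments. Then (1) $af(H_n)=n$; (2) $Af(H_n)=3n$; (3) $\mathrm{Spec}_{af}(H_n)=[n,3n]$, i.e. the set of anti-forcing numbers of perfect matchings of $H_n$ is exactly $\{n,n+1,\dots,3n\}$.
   Context: Pyrene system: draw the hexagonal lattice so that every hexagon has two vertical sides; horizontally adjacent hexagons then share a vertical edge. For $n\ge1$, $H_n$ is the hexagonal system (the plane graph formed by the vertices and edges of the following $4n$ hexagons) consisting of a horizontal linear row of $2n$ hexagons $h_{1,1},h_{1,2},\dots,h_{n,1},h_{n,2}$, consecutive ones sharing a vertical edge, together with, for each $i$, a hexagon $s_{i,1}$ directly above and a hexagon $s_{i,2}$ directly below the common edge of $h_{i,1}$ and $h_{i,2}$ (each sharing an edge with both $h_{i,1}$ and $h_{i,2}$). For a perfect matching $M$ of $G$, an anti-forcing set of $M$ is a set $S\subseteq E(G)\setminus M$ such that $M$ is the unique perfect matching of $G-S$; the anti-forcing number $af(G,M)$ is the minimum size of an anti-forcing set of $M$. $af(G)$ and $Af(G)$ denote the minimum and maximum of $af(G,M)$ over all perfect matchings $M$ of $G$, and $\mathrm{Spec}_{af}(G)$ is the set of values $af(G,M)$ over all perfect matchings $M$. *)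

theory Defs
  imports Main
begin

text \<open>Graphs are given by a vertex set V and a set E of edges, each edge a 2-element set of vertices.\<close>

definition perfect_matching :: "'a set \<Rightarrow> 'a set set \<Rightarrow> 'a set set \<Rightarrow> bool" where
  "perfect_matching V E M \<longleftrightarrow> M \<subseteq> E \<and> (\<forall>v\<in>V. \<exists>!e. e \<in> M \<and> v \<in> e)"

definition anti_forcing_set :: "'a set \<Rightarrow> 'a set set \<Rightarrow> 'a set set \<Rightarrow> 'a set set \<Rightarrow> bool" where
  "anti_forcing_set V E M S \<longleftrightarrow> S \<subseteq> E - M \<and>
     (\<forall>M'. perfect_matching V (E - S) M' \<longrightarrow> M' = M)"

definition af :: "'a set \<Rightarrow> 'a set set \<Rightarrow> 'a set set \<Rightarrow> nat" where
  "af V E M = Min {card S | S. anti_forcing_set V E M S}"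

definition spec_af :: "'a set \<Rightarrow> 'a set set \<Rightarrow> nat set" where
  "spec_af V E = {af V E M | M. perfect_matching V E M}"

definition af_min :: "'a set \<Rightarrow> 'a set set \<Rightarrow> nat" where
  "af_min V E = Min (spec_af V E)"

definition af_max :: "'a set \<Rightarrow> 'a set set \<Rightarrow> nat" where
  "af_max V E = Max (spec_af V E)"

text \<open>Hexagonal lattice in brick-wall coordinates: the hexagon with corner (a,b)
  (a+b even) has vertices (a..a+2, b) and (a..a+2, b+1); its two vertical sides
  are {(a,b),(a,b+1)} and {(a+2,b),(a+2,b+1)}; horizontally adjacent hexagons
  (a and a+2) share a vertical edge.\<close>

definition hex_edges :: "int \<Rightarrow> int \<Rightarrow> (int \<times> int) set set" where
  "hex_edges a b = {{(a,b),(a+1,b)}, {(a+1,b),(a+2,b)},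
                    {(a,b+1),(a+1,b+1)}, {(a+1,b+1),(a+2,b+1)},
                    {(a,b),(a,b+1)}, {(a+2,b),(a+2,b+1)}}"

text \<open>Hexagons of H_n (index i = 0..n-1): h_{i,1} at (4i,0), h_{i,2} at (4i+2,0),
  s_{i,1} at (4i+1,1) above their common edge, s_{i,2} at (4i+1,-1) below it.\<close>

definition pyrene_hexagons :: "nat \<Rightarrow> (int \<times> int) set" where
  "pyrene_hexagons n =
     (\<Union>i<n. {(4 * int i, 0), (4 * int i + 2, 0), (4 * int i + 1, 1), (4 * int i + 1, -1)})"

definition pyrene_E :: "nat \<Rightarrow> (int \<times> int) set set" where
  "pyrene_E n = (\<Union>(a,b)\<in>pyrene_hexagons n. hex_edges a b)"

definition pyrene_V :: "nat \<Rightarrow> (int \<times> int) set" where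
  "pyrene_V n = \<Union>(pyrene_E n)"

end

theory Submission
  imports Defs
begin

text \<open>
  Cut \<open>H\<^sub>n\<close> along the vertical edges between consecutive fragments. A parity argument from left to
  right shows that a perfect matching uses both or none of the two horizontal edges at such a cut on
  either side. So it restricts to a fragment in one of six ways: four in which both hexagons
  \<open>s\<^sub>i\<^sub>,\<^sub>1\<close> and \<open>s\<^sub>i\<^sub>,\<^sub>2\<close> are alternating, one reaching out to the left and one to the right, in
  which \<open>h\<^sub>i\<^sub>,\<^sub>1\<close> resp. \<open>h\<^sub>i\<^sub>,\<^sub>2\<close> is alternating.

  An anti-forcing set meets the non-matching edges of every alternating hexagon. Choosing one
  alternating hexagon per fragment gives \<open>af \<ge> n\<close>. Three edges of a fragment suffice to fix its
  restriction, hence \<open>af \<le> 3n\<close>.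

  To attain every value, take \<open>j\<close> fragments reaching out to the left, then \<open>l\<close> fragments
  in which only \<open>s\<^sub>i\<^sub>,\<^sub>1\<close> and \<open>s\<^sub>i\<^sub>,\<^sub>2\<close> are alternating, then \<open>m\<close> fragments in which also
  \<open>h\<^sub>i\<^sub>,\<^sub>1\<close> is. The contributions are 1, 2 and 3: in the initial run, deleting the
  vertical edge at the left end of each fragment forces the fragments one after the other.
\<close>

section \<open>The pyrene graph and its perfect matchings\<close>

definition hor :: "int \<Rightarrow> int \<Rightarrow> (int \<times> int) set" where
  "hor x y = {(x, y), (x + 1, y)}"

definition ver :: "int \<Rightarrow> int \<Rightarrow> (int \<times> int) set" where
  "ver x y = {(x, y), (x, y + 1)}"

lemma numeral_plus_column: "numeral k + 4 * int i = 4 * int i + numeral k"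
  by simp

lemma hor_eq_iff [simp]: "hor x y = hor x' y' \<longleftrightarrow> x = x' \<and> y = y'"
  by (auto simp: hor_def doubleton_eq_iff)

lemma ver_eq_iff [simp]: "ver x y = ver x' y' \<longleftrightarrow> x = x' \<and> y = y'"
  by (auto simp: ver_def doubleton_eq_iff)

lemma hor_neq_ver [simp]: "hor x y \<noteq> ver x' y'" "ver x' y' \<noteq> hor x y"
  by (auto simp: hor_def ver_def doubleton_eq_iff)

lemma mem_hor_iff: "(x, y) \<in> hor x' y' \<longleftrightarrow> y = y' \<and> (x = x' \<or> x = x' + 1)"
  by (auto simp: hor_def)

lemma mem_ver_iff: "(x, y) \<in> ver x' y' \<longleftrightarrow> x = x' \<and> (y = y' \<or> y = y' + 1)"
  by (auto simp: ver_def)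

lemma hex_edges_eq:
  "hex_edges a b = {hor a b, hor (a + 1) b, hor a (b + 1), hor (a + 1) (b + 1), ver a b, ver (a + 2) b}"
  by (simp add: hex_edges_def hor_def ver_def add.commute[of 2 a])

lemma pyrene_E_eq:
  "pyrene_E n = (\<Union>i<n. let a = 4 * int i in
     hex_edges a 0 \<union> hex_edges (a + 2) 0 \<union> hex_edges (a + 1) 1 \<union> hex_edges (a + 1) (-1))"
  by (auto simp: pyrene_E_def pyrene_hexagons_def Let_def)

lemma finite_pyrene_E [simp]: "finite (pyrene_E n)"
  by (simp add: pyrene_E_eq Let_def hex_edges_def)

lemma column_cases:
  assumes "0 \<le> x" "x < 4 * int n"
  obtains i k where "i < n" "x = 4 * int i + k" "k \<in> {0, 1, 2, 3}"
proof
  show "nat (x div 4) < n" "x = 4 * int (nat (x div 4)) + x mod 4"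
    using assms by (linarith, simp add: pos_imp_zdiv_nonneg_iff)
  show "x mod 4 \<in> {0, 1, 2, 3}" by simp presburger
qed

lemma hor_in_pyrene_E_iff:
  "hor x y \<in> pyrene_E n \<longleftrightarrow>
    0 \<le> x \<and> x < 4 * int n \<and> (y \<in> {0, 1} \<or> y \<in> {-1, 2} \<and> x mod 4 \<in> {1, 2})"
proof
  assume asm: "0 \<le> x \<and> x < 4 * int n \<and> (y \<in> {0, 1} \<or> y \<in> {-1, 2} \<and> x mod 4 \<in> {1, 2})"
  then obtain i k where ik: "i < n" "x = 4 * int i + k" "k \<in> {0, 1, 2, 3}"
    using column_cases by blast
  then have "y \<in> {0, 1} \<or> y \<in> {-1, 2} \<and> k \<in> {1, 2}"
    using asm by auto
  with ik(3) have "hor (4 * int i + k) y \<in> hex_edges (4 * int i) 0 \<union> hex_edges (4 * int i + 2) 0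
      \<union> hex_edges (4 * int i + 1) 1 \<union> hex_edges (4 * int i + 1) (-1)"
    unfolding hex_edges_eq by auto
  with ik(1,2) show "hor x y \<in> pyrene_E n"
    unfolding pyrene_E_eq Let_def by blast
qed (auto simp: pyrene_E_eq hex_edges_eq Let_def)

lemma ver_in_pyrene_E_iff:
  "ver x y \<in> pyrene_E n \<longleftrightarrow>
    n > 0 \<and> 0 \<le> x \<and> x \<le> 4 * int n \<and> (y = 0 \<and> even x \<or> y \<in> {-1, 1} \<and> odd x)"
proof
  assume asm: "n > 0 \<and> 0 \<le> x \<and> x \<le> 4 * int n \<and> (y = 0 \<and> even x \<or> y \<in> {-1, 1} \<and> odd x)"
  show "ver x y \<in> pyrene_E n"
  proof (cases "x = 4 * int n")
    case True
    with asm show ?thesis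
      unfolding pyrene_E_eq hex_edges_eq Let_def by (intro UN_I[of "n - 1"]) auto
  next
    case False
    with asm have "0 \<le> x" "x < 4 * int n" by auto
    then obtain i k where "i < n" "x = 4 * int i + k" "k \<in> {0, 1, 2, 3}"
      by (rule column_cases)
    with asm show ?thesis
      unfolding pyrene_E_eq hex_edges_eq Let_def by (intro UN_I[of i]) auto
  qed
qed (auto simp: pyrene_E_eq hex_edges_eq Let_def)

lemma pyrene_E_cases:
  assumes "e \<in> pyrene_E n"
  obtains x y where "e = hor x y" | x y where "e = ver x y"
  using assms by (auto simp: pyrene_E_eq hex_edges_eq Let_def)

lemma pyrene_E_incident:
  assumes "e \<in> pyrene_E n"
  shows "(x, y) \<in> e \<longleftrightarrow> e \<in> {hor x y, hor (x - 1) y, ver x y, ver x (y - 1)}"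
  using assms by (elim pyrene_E_cases) (auto simp: mem_hor_iff mem_ver_iff)

lemma pyrene_V_iff:
  "(x, y) \<in> pyrene_V n \<longleftrightarrow> n > 0 \<and> 0 \<le> x \<and> x \<le> 4 * int n \<and>
     (y \<in> {0, 1} \<or> y \<in> {-1, 2} \<and> x mod 4 \<noteq> 0)"
    (is "_ \<longleftrightarrow> ?R")
proof -
  have V: "(x, y) \<in> pyrene_V n \<longleftrightarrow> hor x y \<in> pyrene_E n \<or> hor (x - 1) y \<in> pyrene_E n
      \<or> ver x y \<in> pyrene_E n \<or> ver x (y - 1) \<in> pyrene_E n"
    unfolding pyrene_V_def using pyrene_E_incident[of _ n x y] by auto
  have 1: "?R" if "hor x y \<in> pyrene_E n"
    using that by (auto simp: hor_in_pyrene_E_iff)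
  have 2: "?R" if "hor (x - 1) y \<in> pyrene_E n"
  proof -
    have "x mod 4 \<noteq> 0" if "(x - 1) mod 4 = 1 \<or> (x - 1) mod 4 = 2"
      using that by presburger
    with that show ?thesis by (auto simp: hor_in_pyrene_E_iff)
  qed
  have 3: "?R" if "ver x y' \<in> pyrene_E n" "y = y' \<or> y = y' + 1" for y'
  proof -
    have "x mod 4 \<noteq> 0" if "odd x" using that by presburger
    with that show ?thesis by (auto simp: ver_in_pyrene_E_iff)
  qed
  have 4: "(x, y) \<in> pyrene_V n" if R: ?R
  proof (cases "x = 4 * int n")
    case True
    with R show ?thesis unfolding V by (auto simp: hor_in_pyrene_E_iff)
  next
    case False
    with R have "0 \<le> x" "x < 4 * int n" by auto
    then obtain i k where "i < n" "x = 4 * int i + k" "k \<in> {0, 1, 2, 3}"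
      by (rule column_cases)
    with R \<open>x < 4 * int n\<close> show ?thesis unfolding V by (auto simp: hor_in_pyrene_E_iff)
  qed
  have 5: "?R" if "(x, y) \<in> pyrene_V n"
    using that unfolding V by (elim disjE) (erule 1, erule 2, erule 3, simp, erule 3, simp)
  show ?thesis by (rule iffI[OF 5 4])
qed

definition exactly_one :: "bool \<Rightarrow> bool \<Rightarrow> bool \<Rightarrow> bool \<Rightarrow> bool" where
  "exactly_one p q r s \<longleftrightarrow> (p \<or> q \<or> r \<or> s) \<and> \<not> (p \<and> q) \<and> \<not> (p \<and> r) \<and> \<not> (p \<and> s)
     \<and> \<not> (q \<and> r) \<and> \<not> (q \<and> s) \<and> \<not> (r \<and> s)"

lemma perfect_matching_pyrene_iff:
  "perfect_matching (pyrene_V n) (pyrene_E n) M \<longleftrightarrow> M \<subseteq> pyrene_E n \<and>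
    (\<forall>x y. (x, y) \<in> pyrene_V n \<longrightarrow>
      exactly_one (hor x y \<in> M) (hor (x - 1) y \<in> M) (ver x y \<in> M) (ver x (y - 1) \<in> M))"
proof (cases "M \<subseteq> pyrene_E n")
  case True
  have "(\<exists>!e. e \<in> M \<and> (x, y) \<in> e) \<longleftrightarrow>
     exactly_one (hor x y \<in> M) (hor (x - 1) y \<in> M) (ver x y \<in> M) (ver x (y - 1) \<in> M)" for x y
  proof -
    have "(\<lambda>e. e \<in> M \<and> (x, y) \<in> e) = (\<lambda>e. e \<in> M \<and> e \<in> {hor x y, hor (x - 1) y, ver x y, ver x (y - 1)})"
      using True pyrene_E_incident by blast
    moreover have "hor x y \<noteq> hor (x - 1) y" "ver x y \<noteq> ver x (y - 1)" by simp_all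
    ultimately show ?thesis unfolding exactly_one_def
      by (smt (verit) hor_neq_ver insert_iff empty_iff)
  qed
  with True show ?thesis by (simp add: perfect_matching_def Ball_def)
qed (simp add: perfect_matching_def)

locale pyrene_matching =
  fixes n :: nat and M :: "(int \<times> int) set set"
  assumes pm: "perfect_matching (pyrene_V n) (pyrene_E n) M"
begin

lemma M_subset: "M \<subseteq> pyrene_E n"
  using pm by (simp add: perfect_matching_def)

lemma vertex:
  "(x, y) \<in> pyrene_V n \<Longrightarrow>
    exactly_one (hor x y \<in> M) (hor (x - 1) y \<in> M) (ver x y \<in> M) (ver x (y - 1) \<in> M)"
  using pm by (simp add: perfect_matching_pyrene_iff)

lemma hor_notin: "hor x y \<notin> pyrene_E n \<Longrightarrow> hor x y \<in> M \<longleftrightarrow> False"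
  and ver_notin: "ver x y \<notin> pyrene_E n \<Longrightarrow> ver x y \<in> M \<longleftrightarrow> False"
  using M_subset by auto

text \<open>The four edges that determine the matching inside a fragment: it runs out of the fragment
  to the left or to the right, or else it restricts to one of the two perfect matchings of each of
  the hexagons above and below.\<close>

definition lft where "lft i \<longleftrightarrow> hor (4 * int i) 0 \<in> M"
definition rgt where "rgt i \<longleftrightarrow> hor (4 * int i + 3) 0 \<in> M"
definition upr where "upr i \<longleftrightarrow> hor (4 * int i + 1) 2 \<in> M"
definition lwr where "lwr i \<longleftrightarrow> hor (4 * int i + 1) (-1) \<in> M"

lemma vertices:
  assumes "i < n"
  defines "a \<equiv> 4 * int i"
  shows
   "exactly_one (hor (a+1) 1 \<in> M) (hor a 1 \<in> M) (ver (a+1) 1 \<in> M) False" (is ?v1)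
   "exactly_one (hor (a+2) 1 \<in> M) (hor (a+1) 1 \<in> M) False (ver (a+2) 0 \<in> M)" (is ?v2)
   "exactly_one (hor (a+3) 1 \<in> M) (hor (a+2) 1 \<in> M) (ver (a+3) 1 \<in> M) False" (is ?v3)
   "exactly_one (hor (a+1) 2 \<in> M) False False (ver (a+1) 1 \<in> M)" (is ?v4)
   "exactly_one (hor (a+2) 2 \<in> M) (hor (a+1) 2 \<in> M) False False" (is ?v5)
   "exactly_one False (hor (a+2) 2 \<in> M) False (ver (a+3) 1 \<in> M)" (is ?v6)
   "exactly_one (hor (a+1) 0 \<in> M) (hor a 0 \<in> M) False (ver (a+1) (-1) \<in> M)" (is ?v7)
   "exactly_one (hor (a+2) 0 \<in> M) (hor (a+1) 0 \<in> M) (ver (a+2) 0 \<in> M) False" (is ?v8)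
   "exactly_one (hor (a+3) 0 \<in> M) (hor (a+2) 0 \<in> M) False (ver (a+3) (-1) \<in> M)" (is ?v9)
   "exactly_one (hor (a+1) (-1) \<in> M) False (ver (a+1) (-1) \<in> M) False" (is ?v10)
   "exactly_one (hor (a+2) (-1) \<in> M) (hor (a+1) (-1) \<in> M) False False" (is ?v11)
   "exactly_one False (hor (a+2) (-1) \<in> M) (ver (a+3) (-1) \<in> M) False" (is ?v12)
proof -
  have [simp]: "(a+1) mod 4 = 1" "(a+2) mod 4 = 2" "(a+3) mod 4 = 3" "a mod 4 = 0" "even a"
    "a \<ge> 0" "a < 4 * int n" "a + 1 < 4 * int n" "a + 2 < 4 * int n" "a + 3 < 4 * int n"
    "a + 1 \<le> 4 * int n" "a + 2 \<le> 4 * int n" "a + 3 \<le> 4 * int n" "0 < n"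
    "1 + a = a + 1" "2 + a = a + 2"
    using assms by (simp_all add: mod_simps)
  note [simp] = hor_in_pyrene_E_iff ver_in_pyrene_E_iff pyrene_V_iff hor_notin ver_notin
  show ?v1 ?v2 ?v3 ?v4 ?v5 ?v6 ?v7 ?v8 ?v9 ?v10 ?v11 ?v12
    using vertex[of "a+1" 1] vertex[of "a+2" 1] vertex[of "a+3" 1]
      vertex[of "a+1" 2] vertex[of "a+2" 2] vertex[of "a+3" 2]
      vertex[of "a+1" 0] vertex[of "a+2" 0] vertex[of "a+3" 0]
      vertex[of "a+1" "-1"] vertex[of "a+2" "-1"] vertex[of "a+3" "-1"]
    by simp_all
qed

lemma boundary_vertices:
  assumes "i \<le> n" "n > 0"
  defines "a \<equiv> 4 * int i"
  shows
   "exactly_one (hor a 0 \<in> M) (hor (a-1) 0 \<in> M) (ver a 0 \<in> M) False" (is ?v1)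
   "exactly_one (hor a 1 \<in> M) (hor (a-1) 1 \<in> M) False (ver a 0 \<in> M)" (is ?v2)
proof -
  have [simp]: "a mod 4 = 0" "even a" "a \<ge> 0" "a \<le> 4 * int n"
    using assms by simp_all
  note [simp] = hor_in_pyrene_E_iff ver_in_pyrene_E_iff pyrene_V_iff hor_notin ver_notin
  show ?v1 ?v2
    using vertex[of a 0] vertex[of a 1] assms(2) by simp_all
qed

lemma right_sides_agree:
  assumes "i < n" "hor (4 * int i) 0 \<in> M \<longleftrightarrow> hor (4 * int i) 1 \<in> M"
  shows "hor (4 * int i + 3) 0 \<in> M \<longleftrightarrow> hor (4 * int i + 3) 1 \<in> M"
  using vertices[OF assms(1)] assms(2) unfolding exactly_one_def by argo

lemma left_sides_agree:
  "i \<le> n \<Longrightarrow> n > 0 \<Longrightarrow> hor (4 * int i) 0 \<in> M \<longleftrightarrow> hor (4 * int i) 1 \<in> M"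
proof (induction i)
  case 0
  have "hor (-1) 0 \<notin> M" "hor (-1) 1 \<notin> M"
    by (simp_all add: hor_notin hor_in_pyrene_E_iff)
  with boundary_vertices[OF 0] show ?case
    by (auto simp: exactly_one_def)
next
  case (Suc i)
  then have "hor (4 * int i + 3) 0 \<in> M \<longleftrightarrow> hor (4 * int i + 3) 1 \<in> M"
    by (intro right_sides_agree) auto
  moreover have eq: "4 * int (Suc i) - 1 = 4 * int i + 3" by simp
  ultimately show ?case
    using boundary_vertices[OF Suc.prems, unfolded eq] unfolding exactly_one_def by argo
qed

lemma sides_agree:
  assumes "i < n"
  shows "hor (4 * int i) 0 \<in> M \<longleftrightarrow> hor (4 * int i) 1 \<in> M"
    "hor (4 * int i + 3) 0 \<in> M \<longleftrightarrow> hor (4 * int i + 3) 1 \<in> M"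
  using left_sides_agree[of i] right_sides_agree[of i] assms by auto

lemma fragment:
  assumes "i < n"
  defines "a \<equiv> 4 * int i"
  shows "lft i \<Longrightarrow> upr i \<and> lwr i" "rgt i \<Longrightarrow> \<not> upr i \<and> \<not> lwr i"
    "hor a 0 \<in> M \<longleftrightarrow> lft i" "hor a 1 \<in> M \<longleftrightarrow> lft i"
    "hor (a+3) 0 \<in> M \<longleftrightarrow> rgt i" "hor (a+3) 1 \<in> M \<longleftrightarrow> rgt i"
    "ver (a+2) 0 \<in> M \<longleftrightarrow> lft i \<or> rgt i"
    "hor (a+1) 1 \<in> M \<longleftrightarrow> upr i \<and> \<not> lft i" "hor (a+2) 1 \<in> M \<longleftrightarrow> \<not> upr i \<and> \<not> rgt i"
    "hor (a+1) 0 \<in> M \<longleftrightarrow> lwr i \<and> \<not> lft i" "hor (a+2) 0 \<in> M \<longleftrightarrow> \<not> lwr i \<and> \<not> rgt i"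
    "hor (a+1) 2 \<in> M \<longleftrightarrow> upr i" "hor (a+2) 2 \<in> M \<longleftrightarrow> \<not> upr i"
    "hor (a+1) (-1) \<in> M \<longleftrightarrow> lwr i" "hor (a+2) (-1) \<in> M \<longleftrightarrow> \<not> lwr i"
    "ver (a+1) 1 \<in> M \<longleftrightarrow> \<not> upr i" "ver (a+3) 1 \<in> M \<longleftrightarrow> upr i"
    "ver (a+1) (-1) \<in> M \<longleftrightarrow> \<not> lwr i" "ver (a+3) (-1) \<in> M \<longleftrightarrow> lwr i"
  unfolding a_def lft_def rgt_def upr_def lwr_def
  using vertices[OF assms(1)] sides_agree[OF assms(1)] unfolding exactly_one_def by argo+

end

section \<open>Lower bounds from alternating hexagons\<close>

lemma finite_anti_forcing_sets:
  assumes "finite E"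
  shows "finite {S. anti_forcing_set V E M S}"
  by (rule finite_subset[of _ "Pow E"]) (use assms in \<open>auto simp: anti_forcing_set_def\<close>)

lemma af_le_card:
  assumes "finite E" "anti_forcing_set V E M S"
  shows "af V E M \<le> card S"
  unfolding af_def using finite_anti_forcing_sets[OF assms(1)] assms(2)
  by (intro Min_le) (auto simp: setcompr_eq_image)

lemma af_obtain:
  assumes "finite E" "anti_forcing_set V E M S\<^sub>0"
  obtains S where "anti_forcing_set V E M S" "finite S" "af V E M = card S"
proof -
  have "af V E M \<in> {card S | S. anti_forcing_set V E M S}"
    unfolding af_def using finite_anti_forcing_sets[OF assms(1)] assms(2)
    by (intro Min_in) (auto simp: setcompr_eq_image)
  then show ?thesis
    using that assms(1) by (auto simp: anti_forcing_set_def intro: finite_subset)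
qed

lemma anti_forcing_set_meets_alternating:
  assumes pm: "perfect_matching V E M" and S: "anti_forcing_set V E M S"
    and A: "A \<subseteq> M" and B: "B \<subseteq> E" "B \<inter> M = {}" "B \<noteq> {}" and "\<Union>A = \<Union>B"
    and B_matching: "\<And>f g. f \<in> B \<Longrightarrow> g \<in> B \<Longrightarrow> f \<inter> g \<noteq> {} \<Longrightarrow> f = g"
  shows "S \<inter> B \<noteq> {}"
proof
  assume "S \<inter> B = {}"
  have "perfect_matching V (E - S) (M - A \<union> B)"
    unfolding perfect_matching_def
  proof (intro conjI ballI)
    show "M - A \<union> B \<subseteq> E - S"
      using pm S B \<open>S \<inter> B = {}\<close> by (auto simp: perfect_matching_def anti_forcing_set_def)
  next
    fix v assume "v \<in> V"
    then obtain e where e: "e \<in> M" "v \<in> e" and uniq: "\<And>e'. e' \<in> M \<Longrightarrow> v \<in> e' \<Longrightarrow> e' = e"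
      using pm unfolding perfect_matching_def by metis
    show "\<exists>!e. e \<in> M - A \<union> B \<and> v \<in> e"
    proof (cases "e \<in> A")
      case True
      then obtain f where "f \<in> B" "v \<in> f" using e \<open>\<Union>A = \<Union>B\<close> by blast
      then show ?thesis using uniq True B_matching by blast
    next
      case False
      then have "v \<notin> \<Union>B" using uniq A \<open>\<Union>A = \<Union>B\<close> by blast
      then show ?thesis using e uniq False by blast
    qed
  qed
  with S have "M - A \<union> B = M" unfolding anti_forcing_set_def by iprover
  then have "B \<subseteq> M" by blast
  with B show False by blast
qed

definition hex_left :: "int \<Rightarrow> int \<Rightarrow> (int \<times> int) set set" where
  "hex_left x y = {hor x y, hor x (y + 1), ver (x + 2) y}"

definition hex_right :: "int \<Rightarrow> int \<Rightarrow> (int \<times> int) set set" where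
  "hex_right x y = {hor (x + 1) y, hor (x + 1) (y + 1), ver x y}"

lemma Union_hex_left: "\<Union>(hex_left x y) = \<Union>(hex_right x y)"
  by (auto simp: hex_left_def hex_right_def hor_def ver_def)

lemma hex_left_matching: "f \<in> hex_left x y \<Longrightarrow> g \<in> hex_left x y \<Longrightarrow> f \<inter> g \<noteq> {} \<Longrightarrow> f = g"
  and hex_right_matching: "f \<in> hex_right x y \<Longrightarrow> g \<in> hex_right x y \<Longrightarrow> f \<inter> g \<noteq> {} \<Longrightarrow> f = g"
  by (auto simp: hex_left_def hex_right_def hor_def ver_def)

lemma sum_le_card_disjoint:
  fixes w :: "'b \<Rightarrow> nat"
  assumes "finite S" "finite I" "\<And>i. i \<in> I \<Longrightarrow> w i \<le> card (S \<inter> R i)"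
    and "\<And>i j. i \<in> I \<Longrightarrow> j \<in> I \<Longrightarrow> i \<noteq> j \<Longrightarrow> R i \<inter> R j = {}"
  shows "sum w I \<le> card S"
proof -
  have "sum w I \<le> (\<Sum>i\<in>I. card (S \<inter> R i))" using assms by (intro sum_mono) auto
  also have "\<dots> = card (\<Union>i\<in>I. S \<inter> R i)"
    using assms by (intro card_UN_disjoint[symmetric]) blast+
  also have "\<dots> \<le> card S" using assms(1) by (intro card_mono) auto
  finally show ?thesis .
qed

context pyrene_matching
begin

lemma anti_forcing_meets_hex_left:
  assumes "anti_forcing_set (pyrene_V n) (pyrene_E n) M S"
    and "hex_right x y \<subseteq> M" "hex_left x y \<inter> M = {}" "hex_left x y \<subseteq> pyrene_E n"
  shows "S \<inter> hex_left x y \<noteq> {}"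
  using anti_forcing_set_meets_alternating[OF pm assms(1,2,4,3) _ Union_hex_left[symmetric] hex_left_matching]
  by (auto simp: hex_left_def)

lemma anti_forcing_meets_hex_right:
  assumes "anti_forcing_set (pyrene_V n) (pyrene_E n) M S"
    and "hex_left x y \<subseteq> M" "hex_right x y \<inter> M = {}" "hex_right x y \<subseteq> pyrene_E n"
  shows "S \<inter> hex_right x y \<noteq> {}"
  using anti_forcing_set_meets_alternating[OF pm assms(1,2,4,3) _ Union_hex_left hex_right_matching]
  by (auto simp: hex_right_def)

lemma boundary_edge:
  assumes "i \<le> n" "n > 0"
  shows "ver (4 * int i) 0 \<in> M \<longleftrightarrow> hor (4 * int i) 0 \<notin> M \<and> hor (4 * int i - 1) 0 \<notin> M"
  using boundary_vertices[OF assms] by (auto simp: exactly_one_def)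

lemma not_rgt_lft:
  assumes "i \<le> n" "n > 0"
  shows "hor (4 * int i) 0 \<notin> M \<or> hor (4 * int i - 1) 0 \<notin> M"
  using boundary_vertices[OF assms] by (auto simp: exactly_one_def)

lemma lft_rgt_exclusive: "i < n \<Longrightarrow> lft i \<Longrightarrow> \<not> rgt i"
  using fragment(1,2) by blast

context
  fixes S i
  assumes S: "anti_forcing_set (pyrene_V n) (pyrene_E n) M S" and i: "i < n"
begin

lemma hexes_subset:
  "hex_left (4 * int i) 0 \<subseteq> pyrene_E n" "hex_right (4 * int i) 0 \<subseteq> pyrene_E n"
  "hex_left (4 * int i + 2) 0 \<subseteq> pyrene_E n"
  "hex_left (4 * int i + 1) 1 \<subseteq> pyrene_E n" "hex_right (4 * int i + 1) 1 \<subseteq> pyrene_E n"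
  "hex_left (4 * int i + 1) (-1) \<subseteq> pyrene_E n" "hex_right (4 * int i + 1) (-1) \<subseteq> pyrene_E n"
  unfolding pyrene_E_eq hex_left_def hex_right_def hex_edges_eq Let_def
  by (intro subset_trans[OF _ UN_upper[of i]]; use i in simp)+

lemma meets_upper:
  assumes "\<not> lft i" "\<not> rgt i"
  shows "S \<inter> (if upr i then hex_right (4 * int i + 1) 1 else hex_left (4 * int i + 1) 1) \<noteq> {}"
proof (cases "upr i")
  case True
  have "S \<inter> hex_right (4 * int i + 1) 1 \<noteq> {}"
    by (rule anti_forcing_meets_hex_right[OF S _ _ hexes_subset(5)])
      (simp_all add: hex_left_def hex_right_def numeral_plus_column fragment(3-)[OF i] True assms)
  with True show ?thesis by simp
next
  case False
  have "S \<inter> hex_left (4 * int i + 1) 1 \<noteq> {}"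
    by (rule anti_forcing_meets_hex_left[OF S _ _ hexes_subset(4)])
      (simp_all add: hex_left_def hex_right_def numeral_plus_column fragment(3-)[OF i] False assms)
  with False show ?thesis by simp
qed

lemma meets_lower:
  assumes "\<not> lft i" "\<not> rgt i"
  shows "S \<inter> (if lwr i then hex_right (4 * int i + 1) (-1) else hex_left (4 * int i + 1) (-1)) \<noteq> {}"
proof (cases "lwr i")
  case True
  have "S \<inter> hex_right (4 * int i + 1) (-1) \<noteq> {}"
    by (rule anti_forcing_meets_hex_right[OF S _ _ hexes_subset(7)])
      (simp_all add: hex_left_def hex_right_def numeral_plus_column fragment(3-)[OF i] True assms)
  with True show ?thesis by simp
next
  case False
  have "S \<inter> hex_left (4 * int i + 1) (-1) \<noteq> {}"
    by (rule anti_forcing_meets_hex_left[OF S _ _ hexes_subset(6)])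
      (simp_all add: hex_left_def hex_right_def numeral_plus_column fragment(3-)[OF i] False assms)
  with False show ?thesis by simp
qed

lemma meets_left_if_lft:
  assumes "lft i"
  shows "S \<inter> hex_right (4 * int i) 0 \<noteq> {}"
  by (rule anti_forcing_meets_hex_right[OF S _ _ hexes_subset(2)])
    (use i in \<open>simp_all add: hex_left_def hex_right_def numeral_plus_column fragment(3-)[OF i] boundary_edge assms\<close>)

lemma meets_left_if_boundary:
  assumes "ver (4 * int i) 0 \<in> M" "upr i" "lwr i"
  shows "S \<inter> hex_left (4 * int i) 0 \<noteq> {}"
proof -
  have "\<not> lft i" using boundary_edge[of i] assms i by (simp add: lft_def)
  moreover have "\<not> rgt i" using fragment(2)[OF i] assms by blast
  ultimately show ?thesis
    by (intro anti_forcing_meets_hex_left[OF S _ _ hexes_subset(1)])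
      (simp_all add: hex_left_def hex_right_def numeral_plus_column fragment(3-)[OF i] assms)
qed

lemma meets_right_if_rgt:
  assumes "rgt i"
  shows "S \<inter> hex_left (4 * int i + 2) 0 \<noteq> {}"
proof -
  have "\<not> lft i" "\<not> upr i" "\<not> lwr i" using fragment(1,2)[OF i] assms by blast+
  moreover have "ver (4 * int i + 4) 0 \<notin> M"
    using boundary_edge[of "Suc i"] assms i by (simp add: rgt_def numeral_plus_column)
  ultimately show ?thesis
    by (intro anti_forcing_meets_hex_left[OF S _ _ hexes_subset(3)])
      (simp_all add: hex_left_def hex_right_def numeral_plus_column fragment(3-)[OF i] assms)
qed

end

text \<open>The boundary edge between two fragments is credited to the left one exactly if that one
  reaches over to it; this makes the blocks disjoint.\<close>

definition block where
  "block i = {hor x y | x y. 4 * int i \<le> x \<and> x < 4 * int i + 4}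
    \<union> {ver x y | x y. 4 * int i < x \<and> x < 4 * int i + 4}
    \<union> (if hor (4 * int i - 1) 0 \<in> M then {} else {ver (4 * int i) 0})
    \<union> (if hor (4 * int i + 3) 0 \<in> M then {ver (4 * int i + 4) 0} else {})"

lemma block_disjoint:
  assumes "i \<noteq> j"
  shows "block i \<inter> block j = {}"
proof -
  have *: "4 * int j - 1 = 4 * int i + 3" if "4 * int j = 4 * int i + 4" for i j :: nat
    using that by simp
  show ?thesis using assms
    by (auto simp: block_def dest: * *[OF sym] split: if_splits)
qed

lemma card_ge_sum_blocks:
  assumes "finite S" "\<And>i. i < n \<Longrightarrow> w i \<le> card (S \<inter> block i)"
  shows "(\<Sum>i<n. w i) \<le> card S"
  using assms block_disjoint by (intro sum_le_card_disjoint[where R = block]) auto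

lemma n_le_card:
  assumes S: "anti_forcing_set (pyrene_V n) (pyrene_E n) M S" and fin: "finite S"
  shows "n \<le> card S"
proof -
  have "1 \<le> card (S \<inter> block i)" if "i < n" for i
  proof -
    have "S \<inter> block i \<noteq> {}"
    proof -
      consider "lft i" | "rgt i" | "\<not> lft i" "\<not> rgt i" by blast
      then show ?thesis
      proof cases
        case 1
        with not_rgt_lft[of i] have "hex_right (4 * int i) 0 \<subseteq> block i"
          using \<open>i < n\<close> by (auto simp: hex_right_def block_def lft_def)
        with meets_left_if_lft[OF S that 1] show ?thesis by blast
      next
        case 2
        then have "hex_left (4 * int i + 2) 0 \<subseteq> block i"
          by (auto simp: hex_left_def block_def rgt_def)
        with meets_right_if_rgt[OF S that 2] show ?thesis by blast
      next
        case 3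
        have "hex_left (4 * int i + 1) 1 \<subseteq> block i" "hex_right (4 * int i + 1) 1 \<subseteq> block i"
          by (auto simp: hex_left_def hex_right_def block_def)
        with meets_upper[OF S that 3] show ?thesis by (auto split: if_splits)
      qed
    qed
    with fin show ?thesis by (simp add: Suc_le_eq card_gt_0_iff)
  qed
  with card_ge_sum_blocks[OF fin, of "\<lambda>_. 1"] show ?thesis by simp
qed

end

section \<open>Anti-forcing sets that fix every fragment\<close>

definition inner_edges :: "nat \<Rightarrow> (int \<times> int) set set" where
  "inner_edges i = (let a = 4 * int i in {hor a 0, hor a 1, hor (a+3) 0, hor (a+3) 1, ver (a+2) 0,
     hor (a+1) 1, hor (a+2) 1, hor (a+1) 0, hor (a+2) 0, hor (a+1) 2, hor (a+2) 2,
     hor (a+1) (-1), hor (a+2) (-1), ver (a+1) 1, ver (a+3) 1, ver (a+1) (-1), ver (a+3) (-1)})"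

lemma pyrene_E_fragment_cases:
  assumes "e \<in> pyrene_E n"
  obtains (inner) i where "i < n" "e \<in> inner_edges i"
  | (boundary) i where "i \<le> n" "n > 0" "e = ver (4 * int i) 0"
proof -
  have "(let a = 4 * int i in
      hex_edges a 0 \<union> hex_edges (a + 2) 0 \<union> hex_edges (a + 1) 1 \<union> hex_edges (a + 1) (-1))
     \<subseteq> inner_edges i \<union> {ver (4 * int i) 0, ver (4 * int (Suc i)) 0}" for i
    unfolding hex_edges_eq inner_edges_def Let_def by simp
  with assms obtain i where i: "i < n"
    and "e \<in> inner_edges i \<union> {ver (4 * int i) 0, ver (4 * int (Suc i)) 0}"
    unfolding pyrene_E_eq by blast
  then consider "e \<in> inner_edges i" | "e = ver (4 * int i) 0" | "e = ver (4 * int (Suc i)) 0"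
    by blast
  then show ?thesis
    using i inner[of i] boundary[of i] boundary[of "Suc i"] by cases linarith+
qed

lemma pyrene_matching_eqI:
  assumes "pyrene_matching n M" "pyrene_matching n N"
    and eq: "\<And>i. i < n \<Longrightarrow> pyrene_matching.lft M i \<longleftrightarrow> pyrene_matching.lft N i"
      "\<And>i. i < n \<Longrightarrow> pyrene_matching.rgt M i \<longleftrightarrow> pyrene_matching.rgt N i"
      "\<And>i. i < n \<Longrightarrow> pyrene_matching.upr M i \<longleftrightarrow> pyrene_matching.upr N i"
      "\<And>i. i < n \<Longrightarrow> pyrene_matching.lwr M i \<longleftrightarrow> pyrene_matching.lwr N i"
  shows "M = N"
proof -
  interpret M: pyrene_matching n M by fact
  interpret N: pyrene_matching n N by fact
  have left: "hor (4 * int i) 0 \<in> M \<longleftrightarrow> hor (4 * int i) 0 \<in> N" if "i \<le> n" for i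
    using that eq(1)[of i] M.hor_notin N.hor_notin
    by (cases "i = n") (auto simp: M.lft_def N.lft_def hor_in_pyrene_E_iff)
  have right: "hor (4 * int i - 1) 0 \<in> M \<longleftrightarrow> hor (4 * int i - 1) 0 \<in> N" if "i \<le> n" for i
  proof (cases i)
    case 0
    then show ?thesis using M.hor_notin N.hor_notin by (simp add: hor_in_pyrene_E_iff)
  next
    case (Suc j)
    then have "4 * int i - 1 = 4 * int j + 3" by simp
    with eq(2)[of j] that Suc show ?thesis by (simp only: M.rgt_def N.rgt_def Suc_le_eq)
  qed
  have "e \<in> M \<longleftrightarrow> e \<in> N" if "e \<in> pyrene_E n" for e
    using that
  proof (cases rule: pyrene_E_fragment_cases)
    case (inner i)
    then show ?thesis
      by (auto simp: inner_edges_def Let_def M.fragment(3-) N.fragment(3-) eq)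
  next
    case (boundary i)
    then show ?thesis using left right by (simp add: M.boundary_edge N.boundary_edge)
  qed
  then show ?thesis using M.M_subset N.M_subset by blast
qed

lemma anti_forcing_set_pyreneI:
  assumes "pyrene_matching n M" "S \<subseteq> pyrene_E n" "S \<inter> M = {}"
    and "\<And>N i. pyrene_matching n N \<Longrightarrow> N \<inter> S = {} \<Longrightarrow> i < n \<Longrightarrow>
       (pyrene_matching.lft N i \<longleftrightarrow> pyrene_matching.lft M i) \<and>
       (pyrene_matching.rgt N i \<longleftrightarrow> pyrene_matching.rgt M i) \<and>
       (pyrene_matching.upr N i \<longleftrightarrow> pyrene_matching.upr M i) \<and>
       (pyrene_matching.lwr N i \<longleftrightarrow> pyrene_matching.lwr M i)"
  shows "anti_forcing_set (pyrene_V n) (pyrene_E n) M S"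
  unfolding anti_forcing_set_def
proof (intro conjI allI impI)
  show "S \<subseteq> pyrene_E n - M" using assms by blast
  fix N assume N: "perfect_matching (pyrene_V n) (pyrene_E n - S) N"
  then have "pyrene_matching n N" "N \<inter> S = {}"
    by (auto simp: perfect_matching_def pyrene_matching_def)
  then show "N = M" using assms by (intro pyrene_matching_eqI) auto
qed

lemma card_UN_le_sum:
  fixes w :: "'a \<Rightarrow> nat"
  assumes "finite I" "\<And>i. i \<in> I \<Longrightarrow> card (T i) \<le> w i"
  shows "card (\<Union>i\<in>I. T i) \<le> sum w I"
  using assms by (intro order_trans[OF card_UN_le sum_mono]) auto

context pyrene_matching
begin

definition forcer where
  "forcer i = (let a = 4 * int i in
    {hor (if upr i then a + 2 else a + 1) 2, hor (if lwr i then a + 2 else a + 1) (-1),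
     if lft i then hor (a + 1) 1 else if rgt i then hor (a + 2) 1 else ver (a + 2) 0})"

lemma card_forcer: "card (forcer i) \<le> 3"
  unfolding forcer_def Let_def by (rule order_trans[OF card_insert_le_m1 ]) (auto simp: card_insert_if)

lemma anti_forcing_forcer:
  "anti_forcing_set (pyrene_V n) (pyrene_E n) M (\<Union>i<n. forcer i)"
proof (rule anti_forcing_set_pyreneI)
  show "pyrene_matching n M" by unfold_locales
  show "(\<Union>i<n. forcer i) \<subseteq> pyrene_E n"
    by (auto simp: forcer_def Let_def hor_in_pyrene_E_iff ver_in_pyrene_E_iff)
  show "(\<Union>i<n. forcer i) \<inter> M = {}"
  proof -
    have "e \<notin> M" if "i < n" "e \<in> forcer i" for e i
      using fragment(1,2)[OF that(1)] that(2)
      by (auto simp: forcer_def Let_def fragment(3-)[OF that(1)] split: if_splits)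
    then show ?thesis by blast
  qed
next
  fix N i assume "pyrene_matching n N" and NS: "N \<inter> (\<Union>i<n. forcer i) = {}" and i: "i < n"
  interpret N: pyrene_matching n N by fact
  from NS i have *: "forcer i \<inter> N = {}" by blast
  show "(N.lft i \<longleftrightarrow> lft i) \<and> (N.rgt i \<longleftrightarrow> rgt i) \<and> (N.upr i \<longleftrightarrow> upr i) \<and> (N.lwr i \<longleftrightarrow> lwr i)"
    using * fragment(1,2)[OF i] N.fragment(1,2)[OF i]
    by (auto simp: forcer_def Let_def N.fragment(3-)[OF i] split: if_splits)
qed

lemma af_bounds:
  "n \<le> af (pyrene_V n) (pyrene_E n) M" "af (pyrene_V n) (pyrene_E n) M \<le> 3 * n"
proof -
  show "n \<le> af (pyrene_V n) (pyrene_E n) M"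
    using af_obtain[OF finite_pyrene_E anti_forcing_forcer] n_le_card by metis
  have "card (\<Union>i<n. forcer i) \<le> 3 * n"
    using card_UN_le_sum[of "{..<n}" forcer "\<lambda>_. 3"] card_forcer by simp
  with af_le_card[OF finite_pyrene_E anti_forcing_forcer]
  show "af (pyrene_V n) (pyrene_E n) M \<le> 3 * n" by linarith
qed

end

section \<open>A matching for every value of the spectrum\<close>

text \<open>Matchings that never leave a fragment to the right and always choose the left matching of the
  upper hexagon; \<open>p\<close> and \<open>b\<close> are the values of \<open>lft\<close> and \<open>lwr\<close> in the fragment, \<open>k\<close> is the
  column modulo 4.\<close>

definition standard_hor :: "bool \<Rightarrow> bool \<Rightarrow> int \<Rightarrow> int \<Rightarrow> bool" where
  "standard_hor p b k y \<longleftrightarrow> k = 0 \<and> p \<and> (y = 0 \<or> y = 1)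
     \<or> k = 1 \<and> (y = 2 \<or> y = 1 \<and> \<not> p \<or> y = 0 \<and> \<not> p \<and> b \<or> y = -1 \<and> b)
     \<or> k = 2 \<and> (y = 0 \<or> y = -1) \<and> \<not> b"

definition standard_ver :: "bool \<Rightarrow> bool \<Rightarrow> int \<Rightarrow> int \<Rightarrow> bool" where
  "standard_ver p b k y \<longleftrightarrow> k = 0 \<and> y = 0 \<and> \<not> p \<or> k = 1 \<and> y = -1 \<and> \<not> b
     \<or> k = 2 \<and> y = 0 \<and> p \<or> k = 3 \<and> (y = 1 \<or> y = -1 \<and> b)"

lemma exactly_one_standard:
  assumes "k \<in> {0, 1, 2, 3}" "y = 0 \<or> y = 1 \<or> (y = -1 \<or> y = 2) \<and> k \<noteq> 0" "p \<Longrightarrow> b"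
  shows "exactly_one (standard_hor p b k y) (k \<noteq> 0 \<and> standard_hor p b (k - 1) y)
    (standard_ver p b k y) (standard_ver p b k (y - 1))"
proof -
  have "k = 0 \<or> k = 1 \<or> k = 2 \<or> k = 3" using assms(1) by simp
  then show ?thesis
    using assms(2,3) unfolding exactly_one_def standard_hor_def standard_ver_def
    by (elim disjE conjE; simp; blast)
qed

definition standard_matching :: "nat \<Rightarrow> (nat \<Rightarrow> bool) \<Rightarrow> (nat \<Rightarrow> bool) \<Rightarrow> (int \<times> int) set set" where
  "standard_matching n p b = insert (ver (4 * int n) 0)
     ({hor x y | x y. 0 \<le> x \<and> x < 4 * int n \<and>
         standard_hor (p (nat (x div 4))) (b (nat (x div 4))) (x mod 4) y} \<union>
      {ver x y | x y. 0 \<le> x \<and> x < 4 * int n \<and>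
         standard_ver (p (nat (x div 4))) (b (nat (x div 4))) (x mod 4) y})"

lemma hor_in_standard_matching:
  "hor x y \<in> standard_matching n p b \<longleftrightarrow> 0 \<le> x \<and> x < 4 * int n \<and>
    standard_hor (p (nat (x div 4))) (b (nat (x div 4))) (x mod 4) y"
  by (simp add: standard_matching_def)

lemma ver_in_standard_matching:
  "ver x y \<in> standard_matching n p b \<longleftrightarrow> x = 4 * int n \<and> y = 0 \<or> 0 \<le> x \<and> x < 4 * int n \<and>
    standard_ver (p (nat (x div 4))) (b (nat (x div 4))) (x mod 4) y"
  by (auto simp add: standard_matching_def)

lemma standard_matching_column:
  assumes "i < n" "k \<in> {0, 1, 2, 3}"
  shows "hor (4 * int i + k) y \<in> standard_matching n p b \<longleftrightarrow> standard_hor (p i) (b i) k y"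
    and "ver (4 * int i + k) y \<in> standard_matching n p b \<longleftrightarrow> standard_ver (p i) (b i) k y"
proof -
  have "(4 * int i + k) div 4 = int i" "(4 * int i + k) mod 4 = k"
    "0 \<le> 4 * int i + k" "4 * int i + k < 4 * int n"
    using assms by auto
  then show "hor (4 * int i + k) y \<in> standard_matching n p b \<longleftrightarrow> standard_hor (p i) (b i) k y"
    and "ver (4 * int i + k) y \<in> standard_matching n p b \<longleftrightarrow> standard_ver (p i) (b i) k y"
    by (simp_all add: hor_in_standard_matching ver_in_standard_matching)
qed

lemma standard_matching_boundary:
  "hor (4 * int i - 1) y \<notin> standard_matching n p b"
proof -
  have "(4 * int i - 1) mod 4 = 3" by presburger
  then show ?thesis by (simp add: hor_in_standard_matching standard_hor_def)
qed

lemma pyrene_matching_standard: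
  assumes "n > 0" and pb: "\<And>i. p i \<Longrightarrow> b i"
  shows "pyrene_matching n (standard_matching n p b)"
  unfolding pyrene_matching_def perfect_matching_pyrene_iff
proof (intro conjI allI impI)
  let ?M = "standard_matching n p b"
  have "hor x y \<in> pyrene_E n" if "hor x y \<in> ?M" for x y
    using that by (auto simp: hor_in_standard_matching hor_in_pyrene_E_iff standard_hor_def)
  moreover have "ver x y \<in> pyrene_E n" if "ver x y \<in> ?M" for x y
  proof -
    have "x mod 4 = 0 \<Longrightarrow> even x" "x mod 4 = 2 \<Longrightarrow> even x" "x mod 4 = 1 \<Longrightarrow> odd x" "x mod 4 = 3 \<Longrightarrow> odd x"
      by presburger+
    with that \<open>n > 0\<close> show ?thesis
      by (auto simp: ver_in_standard_matching ver_in_pyrene_E_iff standard_ver_def)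
  qed
  moreover have "(\<exists>x y. e = hor x y) \<or> (\<exists>x y. e = ver x y)" if "e \<in> ?M" for e
    using that unfolding standard_matching_def by blast
  ultimately show "?M \<subseteq> pyrene_E n" by blast
next
  let ?M = "standard_matching n p b"
  fix x y assume V: "(x, y) \<in> pyrene_V n"
  show "exactly_one (hor x y \<in> ?M) (hor (x - 1) y \<in> ?M) (ver x y \<in> ?M) (ver x (y - 1) \<in> ?M)"
  proof (cases "x = 4 * int n")
    case True
    with V have "y = 0 \<or> y = 1" by (auto simp: pyrene_V_iff)
    with True show ?thesis
      by (auto simp: exactly_one_def hor_in_standard_matching[of "4 * int n"] ver_in_standard_matching
          standard_matching_boundary)
  next
    case False
    with V have "0 \<le> x" "x < 4 * int n" by (auto simp: pyrene_V_iff)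
    then obtain i k where ik: "i < n" "x = 4 * int i + k" "k \<in> {0, 1, 2, 3}"
      by (rule column_cases)
    from V have y: "y = 0 \<or> y = 1 \<or> (y = -1 \<or> y = 2) \<and> k \<noteq> 0"
      using ik(2,3) by (auto simp: pyrene_V_iff)
    have left: "hor (x - 1) y \<in> ?M \<longleftrightarrow> k \<noteq> 0 \<and> standard_hor (p i) (b i) (k - 1) y"
    proof (cases "k = 0")
      case True
      then show ?thesis using ik standard_matching_boundary by simp
    next
      case False
      then have "k - 1 \<in> {0, 1, 2, 3}" using ik(3) by auto
      then show ?thesis using standard_matching_column(1)[OF ik(1), of "k - 1"] ik(2) False
        by (simp add: algebra_simps)
    qed
    have *: "hor x y \<in> ?M \<longleftrightarrow> standard_hor (p i) (b i) k y"
      "ver x z \<in> ?M \<longleftrightarrow> standard_ver (p i) (b i) k z" for z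
      using standard_matching_column[OF ik(1,3)] ik(2) by simp_all
    show ?thesis
      unfolding left * using ik(3) y pb by (rule exactly_one_standard)
  qed
qed

lemma standard_matching_state:
  assumes "n > 0" "\<And>i. p i \<Longrightarrow> b i" "i < n"
  defines "M \<equiv> standard_matching n p b"
  shows "pyrene_matching.lft M i \<longleftrightarrow> p i" "\<not> pyrene_matching.rgt M i"
    "pyrene_matching.upr M i" "pyrene_matching.lwr M i \<longleftrightarrow> b i"
proof -
  interpret pyrene_matching n M
    unfolding M_def using assms by (intro pyrene_matching_standard)
  show "lft i \<longleftrightarrow> p i" "\<not> rgt i" "upr i" "lwr i \<longleftrightarrow> b i"
    using standard_matching_column(1)[OF assms(3), of 0 0 p b]
     standard_matching_column(1)[OF assms(3), of 1 _ p b]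
     standard_matching_column(1)[OF assms(3), of 3 0 p b]
    unfolding lft_def rgt_def upr_def lwr_def by (simp_all add: M_def standard_hor_def)
qed

lemma card_ge_2I: "finite A \<Longrightarrow> x \<in> A \<Longrightarrow> y \<in> A \<Longrightarrow> x \<noteq> y \<Longrightarrow> 2 \<le> card A"
  using card_mono[of A "{x, y}"] by simp

lemma card_ge_3I:
  "finite A \<Longrightarrow> x \<in> A \<Longrightarrow> y \<in> A \<Longrightarrow> z \<in> A \<Longrightarrow> x \<noteq> y \<Longrightarrow> x \<noteq> z \<Longrightarrow> y \<noteq> z \<Longrightarrow> 3 \<le> card A"
  using card_mono[of A "{x, y, z}"] by simp

lemma af_standard_matching:
  assumes "n > 0" and pb: "\<And>i. p i \<Longrightarrow> b i" and p_down: "\<And>i. p (Suc i) \<Longrightarrow> p i"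
  defines "w \<equiv> \<lambda>i. if p i then 1 else if b i then 3 else 2 :: nat"
  shows "af (pyrene_V n) (pyrene_E n) (standard_matching n p b) = (\<Sum>i<n. w i)"
proof (rule antisym)
  define M where "M = standard_matching n p b"
  interpret pyrene_matching n M
    unfolding M_def using assms by (intro pyrene_matching_standard)
  have state: "lft i \<longleftrightarrow> p i" "\<not> rgt i" "upr i" "lwr i \<longleftrightarrow> b i" if "i < n" for i
    using standard_matching_state[OF \<open>n > 0\<close> pb that] by (auto simp: M_def)

  define T where "T i = (let a = 4 * int i in if p i then {ver a 0}
      else if b i then {hor (a + 2) 2, hor (a + 2) (-1), ver (a + 2) 0}
      else {hor (a + 2) 2, hor (a + 1) (-1)})" for i
  have boundary: "hor (4 * int i - 1) 0 \<notin> M" for i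
    using standard_matching_boundary by (simp add: M_def)
  have "anti_forcing_set (pyrene_V n) (pyrene_E n) M (\<Union>i<n. T i)"
  proof (rule anti_forcing_set_pyreneI)
    show "pyrene_matching n M" by unfold_locales
    show "(\<Union>i<n. T i) \<subseteq> pyrene_E n"
      by (auto simp: T_def Let_def hor_in_pyrene_E_iff ver_in_pyrene_E_iff split: if_splits)
    have "e \<notin> M" if "i < n" "e \<in> T i" for e i
      using state[OF that(1)] that
      by (auto simp: T_def Let_def fragment(3-) boundary_edge split: if_splits)
    then show "(\<Union>i<n. T i) \<inter> M = {}" by blast
  next
    fix N i assume "pyrene_matching n N" and NS: "N \<inter> (\<Union>i<n. T i) = {}" and "i < n"
    interpret N: pyrene_matching n N by fact
    have T: "T i \<inter> N = {}" if "i < n" for i using NS that by blast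
    have lft: "N.lft i" if "p i" "i < n" for i
      using that
    proof (induction i)
      case 0
      have "hor (-1) 0 \<notin> N" using N.hor_notin by (simp add: hor_in_pyrene_E_iff)
      with 0 show ?case using T[of 0] N.boundary_edge[of 0] by (simp add: T_def N.lft_def)
    next
      case (Suc i)
      then have "N.lft i" using p_down by simp
      then have "\<not> N.rgt i" using N.lft_rgt_exclusive Suc.prems by simp
      moreover have eq: "4 * int (Suc i) - 1 = 4 * int i + 3" by simp
      ultimately have "hor (4 * int (Suc i) - 1) 0 \<notin> N" unfolding N.rgt_def eq by argo
      moreover have "ver (4 * int (Suc i)) 0 \<notin> N"
        using T[OF Suc.prems(2)] Suc.prems(1) by (simp add: T_def Let_def)
      ultimately show ?case
        using N.boundary_edge[of "Suc i"] Suc.prems(2) by (simp add: N.lft_def)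
    qed
    show "(N.lft i \<longleftrightarrow> lft i) \<and> (N.rgt i \<longleftrightarrow> rgt i) \<and> (N.upr i \<longleftrightarrow> upr i) \<and> (N.lwr i \<longleftrightarrow> lwr i)"
    proof (cases "p i")
      case True
      with lft \<open>i < n\<close> have "N.lft i" by blast
      with N.fragment(1,2)[OF \<open>i < n\<close>] True pb[OF True] show ?thesis
        using state[OF \<open>i < n\<close>] by blast
    next
      case False
      with N.fragment(1,2)[OF \<open>i < n\<close>] T[OF \<open>i < n\<close>] show ?thesis
        using state[OF \<open>i < n\<close>]
        by (auto simp: T_def Let_def N.fragment(3-)[OF \<open>i < n\<close>] split: if_splits)
    qed
  qed
  note T = this
  have "card (T i) \<le> w i" for i
    by (simp add: T_def Let_def w_def card_insert_if)
  then have "card (\<Union>i<n. T i) \<le> (\<Sum>i<n. w i)"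
    by (intro card_UN_le_sum) auto
  with af_le_card[OF finite_pyrene_E T]
  show "af (pyrene_V n) (pyrene_E n) (standard_matching n p b) \<le> (\<Sum>i<n. w i)"
    unfolding M_def by linarith

  obtain S where S: "anti_forcing_set (pyrene_V n) (pyrene_E n) M S" and fin: "finite S"
    and af: "af (pyrene_V n) (pyrene_E n) M = card S"
    using af_obtain[OF finite_pyrene_E T] .
  have "w i \<le> card (S \<inter> block i)" if i: "i < n" for i
  proof (cases "p i")
    case True
    then have "hex_right (4 * int i) 0 \<subseteq> block i"
      using boundary by (auto simp: hex_right_def block_def)
    moreover have "S \<inter> hex_right (4 * int i) 0 \<noteq> {}"
      using meets_left_if_lft[OF S i] state[OF i] True by blast
    ultimately have "S \<inter> block i \<noteq> {}" by blast
    with fin True show ?thesis by (simp add: w_def Suc_le_eq card_gt_0_iff)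
  next
    case False
    then have lr: "\<not> lft i" "\<not> rgt i" using state[OF i] by auto
    obtain x where x: "x \<in> S" "x \<in> hex_right (4 * int i + 1) 1"
      using meets_upper[OF S i lr] state[OF i] by auto
    obtain y where y: "y \<in> S" "y \<in> (if b i then hex_right (4 * int i + 1) (-1) else hex_left (4 * int i + 1) (-1))"
      using meets_lower[OF S i lr] state[OF i] by auto
    have xy: "x \<in> S \<inter> block i" "y \<in> S \<inter> block i" "x \<noteq> y"
      using x y by (auto simp: hex_left_def hex_right_def block_def split: if_splits)
    show ?thesis
    proof (cases "b i")
      case True
      have "ver (4 * int i) 0 \<in> M"
        using boundary_edge[of i] i lr boundary by (simp add: lft_def)
      then obtain z where z: "z \<in> S" "z \<in> hex_left (4 * int i) 0"
        using meets_left_if_boundary[OF S i] state[OF i] True by blast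
      have "z \<in> S \<inter> block i" "x \<noteq> z" "y \<noteq> z"
        using x y z True by (auto simp: hex_left_def hex_right_def block_def)
      with xy fin show ?thesis using \<open>\<not> p i\<close> True by (auto simp: w_def intro!: card_ge_3I[of _ x y z])
    next
      case False
      with xy fin show ?thesis using \<open>\<not> p i\<close> by (auto simp: w_def intro!: card_ge_2I[of _ x y])
    qed
  qed
  then show "(\<Sum>i<n. w i) \<le> af (pyrene_V n) (pyrene_E n) (standard_matching n p b)"
    using card_ge_sum_blocks[OF fin] af by (simp add: M_def)
qed

lemma sum_three_steps:
  fixes x y z :: nat
  shows "(\<Sum>i<j + l + m. if i < j then x else if i < j + l then y else z) = x * j + y * l + z * m"
proof (induction m)
  case 0
  have "(\<Sum>i<j + l. if i < j then x else if i < j + l then y else z) = (\<Sum>i<j + l. if i < j then x else y)"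
    by (intro sum.cong) auto
  also have "\<dots> = x * j + y * l"
    by (induction l) simp_all
  finally show ?case by simp
qed simp

theorem corollary4p3:
  fixes n :: nat
  assumes "n \<ge> 1"
  shows "af_min (pyrene_V n) (pyrene_E n) = n
       \<and> af_max (pyrene_V n) (pyrene_E n) = 3 * n
       \<and> spec_af (pyrene_V n) (pyrene_E n) = {n..3 * n}"
proof -
  have "k \<in> spec_af (pyrene_V n) (pyrene_E n)" if k: "n \<le> k" "k \<le> 3 * n" for k
  proof -
    define m l where "m = (k - n) div 2" and "l = (k - n) mod 2"
    define j where "j = n - (m + l)"
    have "k - n = 2 * m + l" "l \<le> 1" unfolding m_def l_def by simp_all
    with k have n: "n = j + l + m" and k_eq: "k = 1 * j + 2 * l + 3 * m"
      unfolding j_def by linarith+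
    define p where "p i \<longleftrightarrow> i < j" for i
    define b where "b i \<longleftrightarrow> i < j \<or> \<not> i < j + l" for i
    have pb: "\<And>i. p i \<Longrightarrow> b i" and "\<And>i. p (Suc i) \<Longrightarrow> p i"
      by (auto simp: p_def b_def)
    then have "af (pyrene_V n) (pyrene_E n) (standard_matching n p b) =
        (\<Sum>i<n. if p i then 1 else if b i then 3 else 2)"
      using assms by (intro af_standard_matching) auto
    also have "\<dots> = (\<Sum>i<j + l + m. if i < j then 1 else if i < j + l then 2 else 3)"
      unfolding n by (intro sum.cong) (auto simp: p_def b_def)
    also have "\<dots> = k" unfolding sum_three_steps k_eq ..
    finally have "af (pyrene_V n) (pyrene_E n) (standard_matching n p b) = k" .
    moreover have "perfect_matching (pyrene_V n) (pyrene_E n) (standard_matching n p b)"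
      using pyrene_matching_standard[of n p b] pb assms by (simp add: pyrene_matching_def)
    ultimately show ?thesis unfolding spec_af_def by blast
  qed
  moreover have "n \<le> k" "k \<le> 3 * n" if "k \<in> spec_af (pyrene_V n) (pyrene_E n)" for k
    using that pyrene_matching.af_bounds by (auto simp: spec_af_def pyrene_matching_def)
  ultimately have spec: "spec_af (pyrene_V n) (pyrene_E n) = {n..3 * n}" by auto
  then show ?thesis
    by (auto simp: af_min_def af_max_def intro: Min_eqI Max_eqI)
qed

end
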